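(* Let $A$ be an arbitrary C*-algebra and let $\{\mathcal E,\langle\cdot,\cdot\rangle\}$ be a Hilbert $A$-module. Let $B$ be another C*-algebra admitting a $*$-representation in $\mathrm{End}_A^*(\mathcal E)$, so that $\mathcal E$ is a Hilbert $A$-$B$-bimodule. Consider any one of the four categories whose objects are the Hilbert $A$-$B$-bimodules, whose morphisms are one of: (a) the contractive bimodule maps, (b) the adjointable contractive bimodule maps, (c) the bounded bimodule maps, (d) the adjointable bounded bimodule maps; and in each case let the subobjects of an object $\mathcal N$ be those Hilbert $A$-$B$-submodules $\mathcal M\subseteq\mathcal N$ whose inclusion map $\mathcal M\hookrightarrow\mathcal N$ is adjointable. Then $\mathcal E$ is an injective object in this category. Consequently, every object of each of these categories is injective.
   Context: Hilbert $A$-modules are left $A$-modules with an $A$-valued inner product that is $A$-linear in the first argument, complete in the norm $\|x\|=\|\langle x,x\rangle\|^{1/2}$. $\mathrm{End}_A^*(\mathcal E)$ is the C*-algebra of all adjointable bounded $A$-linear operators on $\mathcal E$. For C*-algebras $A,B$, a Hilbert $A$-$B$-bimodule is a Hilbert $A$-module $\mathcal M$ together with a right action of $B$ by bounded adjointable $A$-linear maps given by a $*$-representation, so that $\langle a m_1 b,m_2\rangle=a\langle m_1,m_2b^*\rangle$. A Hilbert $A$-$B$-submodule is a norm-closed subspace invariant under both actions, with the inherited structure. A bounded $A$-linear map $T:\mathcal M\to\mathcal N$ is adjointable if there is $T^*:\mathcal N\to\mathcal M$ with $\langle Tx,y\rangle=\langle x,T^*y\rangle$ for all $x\in\mathcal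 M,y\in\mathcal N$. Given a category (objects, morphisms) together with a specified class of subobjects of each object, an object $\mathcal E$ is injective if for every object $\mathcal N$, every subobject $\mathcal M\subseteq\mathcal N$ and every morphism $\phi:\mathcal M\to\mathcal E$ there is a morphism $\psi:\mathcal N\to\mathcal E$ extending $\phi$. *)

theory Defs
  imports "HOL-Analysis.Analysis"
begin

class complex_vector = ab_group_add +
  fixes scaleC :: "complex \<Rightarrow> 'a \<Rightarrow> 'a"  (infixr "*\<^sub>C" 75)
  assumes scaleC_add_right: "c *\<^sub>C (x + y) = c *\<^sub>C x + c *\<^sub>C y"
    and scaleC_add_left: "(c + d) *\<^sub>C x = c *\<^sub>C x + d *\<^sub>C x"
    and scaleC_scaleC: "c *\<^sub>C (d *\<^sub>C x) = (c * d) *\<^sub>C x"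
    and scaleC_one: "1 *\<^sub>C x = x"

global_interpretation complex_vector:
  vector_space "scaleC :: complex \<Rightarrow> 'a \<Rightarrow> 'a::complex_vector"
  by standard (simp_all add: scaleC_add_right scaleC_add_left scaleC_scaleC scaleC_one)

text \<open>C*-algebras, not necessarily unital; the zero algebra is allowed.\<close>

class cstar_algebra = real_normed_algebra + banach + complex_vector +
  fixes star :: "'a \<Rightarrow> 'a"
  assumes scaleR_scaleC: "r *\<^sub>R a = complex_of_real r *\<^sub>C a"
    and mult_scaleC_left: "(c *\<^sub>C a) * b = c *\<^sub>C (a * b)"
    and mult_scaleC_right: "a * (c *\<^sub>C b) = c *\<^sub>C (a * b)"
    and norm_scaleC: "norm (c *\<^sub>C a) = cmod c * norm a"
    and star_star: "star (star a) = a"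
    and star_add: "star (a + b) = star a + star b"
    and star_scaleC: "star (c *\<^sub>C a) = cnj c *\<^sub>C star a"
    and star_mult: "star (a * b) = star b * star a"
    and cstar_identity: "norm (star a * a) = (norm a)\<^sup>2"

text \<open>Multiplication of the unitization, whose unit is (0, 1). The pair (a, c) stands for a + c1.\<close>

definition unitization_mult ::
  "'a::cstar_algebra \<times> complex \<Rightarrow> 'a \<times> complex \<Rightarrow> 'a \<times> complex" where
  "unitization_mult u v =
     (fst u * fst v + snd u *\<^sub>C fst v + snd v *\<^sub>C fst u, snd u * snd v)"

text \<open>
  The spectrum is always taken in the unitization. If the algebra already has a unit, this
  differs from the spectrum in the algebra itself at most by the point 0, so positivity is the
  same for either choice.
\<close>

definition spectrum :: "'a::cstar_algebra \<Rightarrow> complex set" where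
  "spectrum a = {c. \<not> (\<exists>v. unitization_mult (a, - c) v = (0, 1) \<and>
                            unitization_mult v (a, - c) = (0, 1))}"

definition positive :: "'a::cstar_algebra \<Rightarrow> bool" where
  "positive a \<longleftrightarrow> star a = a \<and> spectrum a \<subseteq> \<real>\<^sub>\<ge>\<^sub>0"

text \<open>
  A module has an explicit carrier inside its ambient vector space, from which it takes addition
  and complex scalars; a submodule then has the same type as the module. Nothing is required of
  the operations, or of maps, outside the carrier.
\<close>

record ('a, 'm) hmod =
  carr :: "'m set"
  lact :: "'a \<Rightarrow> 'm \<Rightarrow> 'm"
  ip :: "'m \<Rightarrow> 'm \<Rightarrow> 'a"

record ('a, 'm, 'b) hbimod = "('a, 'm) hmod" +
  ract :: "'m \<Rightarrow> 'b \<Rightarrow> 'm"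

definition hnorm :: "('a::cstar_algebra, 'm::complex_vector, 'z) hmod_scheme \<Rightarrow> 'm \<Rightarrow> real" where
  "hnorm M x = sqrt (norm (ip M x x))"

definition left_module :: "('a::cstar_algebra, 'm::complex_vector, 'z) hmod_scheme \<Rightarrow> bool" where
  "left_module M \<longleftrightarrow>
     complex_vector.subspace (carr M) \<and>
     (\<forall>a. \<forall>x\<in>carr M. lact M a x \<in> carr M) \<and>
     (\<forall>a. \<forall>x\<in>carr M. \<forall>y\<in>carr M. lact M a (x + y) = lact M a x + lact M a y) \<and>
     (\<forall>a b. \<forall>x\<in>carr M. lact M (a + b) x = lact M a x + lact M b x) \<and>
     (\<forall>a b. \<forall>x\<in>carr M. lact M (a * b) x = lact M a (lact M b x)) \<and>
     (\<forall>c a. \<forall>x\<in>carr M. lact M (c *\<^sub>C a) x = c *\<^sub>C lact M a x) \<and>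
     (\<forall>c a. \<forall>x\<in>carr M. lact M a (c *\<^sub>C x) = c *\<^sub>C lact M a x)"

definition inner_product :: "('a::cstar_algebra, 'm::complex_vector, 'z) hmod_scheme \<Rightarrow> bool" where
  "inner_product M \<longleftrightarrow>
     (\<forall>x\<in>carr M. \<forall>y\<in>carr M. \<forall>z\<in>carr M. ip M (x + y) z = ip M x z + ip M y z) \<and>
     (\<forall>c. \<forall>x\<in>carr M. \<forall>y\<in>carr M. ip M (c *\<^sub>C x) y = c *\<^sub>C ip M x y) \<and>
     (\<forall>a. \<forall>x\<in>carr M. \<forall>y\<in>carr M. ip M (lact M a x) y = a * ip M x y) \<and>
     (\<forall>x\<in>carr M. \<forall>y\<in>carr M. ip M x y = star (ip M y x)) \<and>
     (\<forall>x\<in>carr M. positive (ip M x x)) \<and>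
     (\<forall>x\<in>carr M. ip M x x = 0 \<longrightarrow> x = 0)"

definition hconverges ::
  "('a::cstar_algebra, 'm::complex_vector, 'z) hmod_scheme \<Rightarrow> (nat \<Rightarrow> 'm) \<Rightarrow> 'm \<Rightarrow> bool" where
  "hconverges M X x \<longleftrightarrow> (\<lambda>n. hnorm M (X n - x)) \<longlonglongrightarrow> 0"

definition hCauchy ::
  "('a::cstar_algebra, 'm::complex_vector, 'z) hmod_scheme \<Rightarrow> (nat \<Rightarrow> 'm) \<Rightarrow> bool" where
  "hCauchy M X \<longleftrightarrow> (\<forall>e>0. \<exists>k. \<forall>m\<ge>k. \<forall>n\<ge>k. hnorm M (X m - X n) < e)"

definition hilbert_module :: "('a::cstar_algebra, 'm::complex_vector, 'z) hmod_scheme \<Rightarrow> bool" where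
  "hilbert_module M \<longleftrightarrow>
     left_module M \<and> inner_product M \<and>
     (\<forall>X. range X \<subseteq> carr M \<and> hCauchy M X \<longrightarrow> (\<exists>x\<in>carr M. hconverges M X x))"

definition module_map ::
  "('a::cstar_algebra, 'm::complex_vector, 'y) hmod_scheme \<Rightarrow>
   ('a, 'n::complex_vector, 'z) hmod_scheme \<Rightarrow> ('m \<Rightarrow> 'n) \<Rightarrow> bool" where
  "module_map M N T \<longleftrightarrow>
     (\<forall>x\<in>carr M. T x \<in> carr N) \<and>
     (\<forall>x\<in>carr M. \<forall>y\<in>carr M. T (x + y) = T x + T y) \<and>
     (\<forall>c. \<forall>x\<in>carr M. T (c *\<^sub>C x) = c *\<^sub>C T x) \<and>
     (\<forall>a. \<forall>x\<in>carr M. T (lact M a x) = lact N a (T x))"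

definition bounded_map ::
  "('a::cstar_algebra, 'm::complex_vector, 'y) hmod_scheme \<Rightarrow>
   ('a, 'n::complex_vector, 'z) hmod_scheme \<Rightarrow> ('m \<Rightarrow> 'n) \<Rightarrow> bool" where
  "bounded_map M N T \<longleftrightarrow> (\<exists>K. \<forall>x\<in>carr M. hnorm N (T x) \<le> K * hnorm M x)"

definition contractive_map ::
  "('a::cstar_algebra, 'm::complex_vector, 'y) hmod_scheme \<Rightarrow>
   ('a, 'n::complex_vector, 'z) hmod_scheme \<Rightarrow> ('m \<Rightarrow> 'n) \<Rightarrow> bool" where
  "contractive_map M N T \<longleftrightarrow> (\<forall>x\<in>carr M. hnorm N (T x) \<le> hnorm M x)"

definition is_adjoint ::
  "('a::cstar_algebra, 'm::complex_vector, 'y) hmod_scheme \<Rightarrow>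
   ('a, 'n::complex_vector, 'z) hmod_scheme \<Rightarrow> ('m \<Rightarrow> 'n) \<Rightarrow> ('n \<Rightarrow> 'm) \<Rightarrow> bool" where
  "is_adjoint M N T S \<longleftrightarrow>
     (\<forall>y\<in>carr N. S y \<in> carr M) \<and>
     (\<forall>x\<in>carr M. \<forall>y\<in>carr N. ip N (T x) y = ip M x (S y))"

definition adjointable ::
  "('a::cstar_algebra, 'm::complex_vector, 'y) hmod_scheme \<Rightarrow>
   ('a, 'n::complex_vector, 'z) hmod_scheme \<Rightarrow> ('m \<Rightarrow> 'n) \<Rightarrow> bool" where
  "adjointable M N T \<longleftrightarrow> module_map M N T \<and> bounded_map M N T \<and> (\<exists>S. is_adjoint M N T S)"

definition End_star ::
  "('a::cstar_algebra, 'm::complex_vector, 'z) hmod_scheme \<Rightarrow> ('m \<Rightarrow> 'm) set" where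
  "End_star M = {T. adjointable M M T}"

text \<open>
  Operators are written on the right, as is usual for left modules: the product of S and T
  applies S first, so that a *-representation of B is the same thing as a right action.
  No nondegeneracy is assumed.
\<close>

definition star_representation ::
  "('a::cstar_algebra, 'm::complex_vector, 'z) hmod_scheme \<Rightarrow>
   ('b::cstar_algebra \<Rightarrow> 'm \<Rightarrow> 'm) \<Rightarrow> bool" where
  "star_representation M \<rho> \<longleftrightarrow>
     (\<forall>b. \<rho> b \<in> End_star M) \<and>
     (\<forall>b c. \<forall>x\<in>carr M. \<rho> (b + c) x = \<rho> b x + \<rho> c x) \<and>
     (\<forall>k b. \<forall>x\<in>carr M. \<rho> (k *\<^sub>C b) x = k *\<^sub>C \<rho> b x) \<and>
     (\<forall>b c. \<forall>x\<in>carr M. \<rho> (b * c) x = \<rho> c (\<rho> b x)) \<and>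
     (\<forall>b. is_adjoint M M (\<rho> b) (\<rho> (star b)))"

definition hilbert_bimodule ::
  "('a::cstar_algebra, 'm::complex_vector, 'b::cstar_algebra) hbimod \<Rightarrow> bool" where
  "hilbert_bimodule M \<longleftrightarrow> hilbert_module M \<and> star_representation M (\<lambda>b x. ract M x b)"

definition bimodule_of ::
  "('a::cstar_algebra, 'm::complex_vector) hmod \<Rightarrow> ('b::cstar_algebra \<Rightarrow> 'm \<Rightarrow> 'm) \<Rightarrow>
   ('a, 'm, 'b) hbimod" where
  "bimodule_of E \<rho> = \<lparr>carr = carr E, lact = lact E, ip = ip E, ract = (\<lambda>x b. \<rho> b x)\<rparr>"

definition bimodule_map ::
  "('a::cstar_algebra, 'm::complex_vector, 'b::cstar_algebra) hbimod \<Rightarrow>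
   ('a, 'n::complex_vector, 'b) hbimod \<Rightarrow> ('m \<Rightarrow> 'n) \<Rightarrow> bool" where
  "bimodule_map M N T \<longleftrightarrow>
     module_map M N T \<and> (\<forall>b. \<forall>x\<in>carr M. T (ract M x b) = ract N (T x) b)"

definition contractive_bimodule_map ::
  "('a::cstar_algebra, 'm::complex_vector, 'b::cstar_algebra) hbimod \<Rightarrow>
   ('a, 'n::complex_vector, 'b) hbimod \<Rightarrow> ('m \<Rightarrow> 'n) \<Rightarrow> bool" where
  "contractive_bimodule_map M N T \<longleftrightarrow> bimodule_map M N T \<and> contractive_map M N T"

definition adjointable_contractive_bimodule_map ::
  "('a::cstar_algebra, 'm::complex_vector, 'b::cstar_algebra) hbimod \<Rightarrow>
   ('a, 'n::complex_vector, 'b) hbimod \<Rightarrow> ('m \<Rightarrow> 'n) \<Rightarrow> bool" where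
  "adjointable_contractive_bimodule_map M N T \<longleftrightarrow>
     bimodule_map M N T \<and> contractive_map M N T \<and> adjointable M N T"

definition bounded_bimodule_map ::
  "('a::cstar_algebra, 'm::complex_vector, 'b::cstar_algebra) hbimod \<Rightarrow>
   ('a, 'n::complex_vector, 'b) hbimod \<Rightarrow> ('m \<Rightarrow> 'n) \<Rightarrow> bool" where
  "bounded_bimodule_map M N T \<longleftrightarrow> bimodule_map M N T \<and> bounded_map M N T"

definition adjointable_bounded_bimodule_map ::
  "('a::cstar_algebra, 'm::complex_vector, 'b::cstar_algebra) hbimod \<Rightarrow>
   ('a, 'n::complex_vector, 'b) hbimod \<Rightarrow> ('m \<Rightarrow> 'n) \<Rightarrow> bool" where
  "adjointable_bounded_bimodule_map M N T \<longleftrightarrow>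
     bimodule_map M N T \<and> bounded_map M N T \<and> adjointable M N T"

definition hilbert_submodule ::
  "('a::cstar_algebra, 'n::complex_vector, 'b::cstar_algebra) hbimod \<Rightarrow>
   ('a, 'n, 'b) hbimod \<Rightarrow> bool" where
  "hilbert_submodule M N \<longleftrightarrow>
     M = N\<lparr>carr := carr M\<rparr> \<and>
     carr M \<subseteq> carr N \<and>
     complex_vector.subspace (carr M) \<and>
     (\<forall>X. \<forall>x\<in>carr N. range X \<subseteq> carr M \<and> hconverges N X x \<longrightarrow> x \<in> carr M) \<and>
     (\<forall>a. \<forall>x\<in>carr M. lact N a x \<in> carr M) \<and>
     (\<forall>b. \<forall>x\<in>carr M. ract N x b \<in> carr M)"

definition adjointable_submodule ::
  "('a::cstar_algebra, 'n::complex_vector, 'b::cstar_algebra) hbimod \<Rightarrow>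
   ('a, 'n, 'b) hbimod \<Rightarrow> bool" where
  "adjointable_submodule M N \<longleftrightarrow> hilbert_submodule M N \<and> adjointable M N (\<lambda>x. x)"

text \<open>
  Injectivity in the category of Hilbert bimodules with morphisms mor and subobjects sub.
  HOL cannot quantify over types inside a formula, so the test objects N live on a type
  'n that is a parameter of the definition and is unrelated to that of E; a statement
  with 'n left free covers all of them.
\<close>

definition injective_object ::
  "(('a::cstar_algebra, 'n::complex_vector, 'b::cstar_algebra) hbimod \<Rightarrow>
     ('a, 'n, 'b) hbimod \<Rightarrow> bool) \<Rightarrow>
   (('a, 'n, 'b) hbimod \<Rightarrow> ('a, 'e::complex_vector, 'b) hbimod \<Rightarrow> ('n \<Rightarrow> 'e) \<Rightarrow> bool) \<Rightarrow>
   ('a, 'e, 'b) hbimod \<Rightarrow> bool" where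
  "injective_object sub mor E \<longleftrightarrow>
     hilbert_bimodule E \<and>
     (\<forall>N M \<phi>. hilbert_bimodule N \<and> sub M N \<and> mor M E \<phi> \<longrightarrow>
        (\<exists>\<psi>. mor N E \<psi> \<and> (\<forall>x\<in>carr M. \<psi> x = \<phi> x)))"

end

theory Submission
  imports Defs
begin

text \<open>
  The adjoint \<open>P\<close> of the inclusion of \<open>M\<close> into \<open>N\<close> is an idempotent bimodule map onto \<open>M\<close>, so
  every morphism \<open>\<phi>\<close> on \<open>M\<close> extends to \<open>\<phi> \<circ> P\<close>. That \<open>P\<close> is contractive follows from
  \<open>\<langle>x, x\<rangle> = \<langle>Px, Px\<rangle> + \<langle>x - Px, x - Px\<rangle>\<close> and the fact that \<open>\<parallel>p\<parallel> \<le> \<parallel>p + q\<parallel>\<close> for positive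
  elements \<open>p\<close> and \<open>q\<close> of a C*-algebra. The latter is shown without spectral theory, by
  extracting square roots of left multiplication operators on the algebra.
\<close>

subsection \<open>Norm inequalities for positive elements\<close>

lemma norm_star [simp]: "norm (star a) = norm (a::'a::cstar_algebra)"
proof -
  have le: "norm b \<le> norm (star b)" for b :: 'a
  proof (cases "norm b = 0")
    case False
    have "(norm b)\<^sup>2 \<le> norm (star b) * norm b"
      by (metis cstar_identity norm_mult_ineq)
    with False show ?thesis
      by (simp add: power2_eq_square)
  qed simp
  from le[of a] le[of "star a"] show ?thesis
    by (simp add: star_star)
qed

lemma star_scaleR: "star (r *\<^sub>R a) = r *\<^sub>R star (a::'a::cstar_algebra)"
  by (simp add: scaleR_scaleC star_scaleC)

lemma bounded_linear_star: "bounded_linear (star :: 'a::cstar_algebra \<Rightarrow> 'a)"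
  by (rule bounded_linear_intro[where K = 1]) (simp_all add: star_add star_scaleR)

lemmas star_diff = linear_diff[OF bounded_linear.linear[OF bounded_linear_star]]

section \<open>Self-adjoint operators on the algebra and their square roots\<close>

text \<open>The algebra is viewed as a right module over itself with inner product
  \<open>star b * c\<close>. Working with operators instead of elements supplies a unit,
  \<open>id_blinfun\<close>, and a complete norm without norming the unitization.\<close>

definition selfadj :: "('a::cstar_algebra \<Rightarrow>\<^sub>L 'a) \<Rightarrow> bool" where
  "selfadj T \<longleftrightarrow> (\<forall>b c. star (T b) * c = star b * T c)"

lemma selfadj_swap: "selfadj T \<Longrightarrow> star (T b) * c = star b * T c"
  by (simp add: selfadj_def)

lemma selfadj_id: "selfadj id_blinfun"
  by (simp add: selfadj_def)

lemma selfadj_add: "selfadj S \<Longrightarrow> selfadj T \<Longrightarrow> selfadj (S + T)"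
  by (simp add: selfadj_def plus_blinfun.rep_eq star_add distrib_left distrib_right)

lemma selfadj_scaleR: "selfadj T \<Longrightarrow> selfadj (r *\<^sub>R T)"
  by (simp add: selfadj_def scaleR_blinfun.rep_eq star_scaleR)

lemma selfadj_diff: "selfadj S \<Longrightarrow> selfadj T \<Longrightarrow> selfadj (S - T)"
  using selfadj_add[of S "(-1) *\<^sub>R T"] selfadj_scaleR[of T "-1"] by simp

lemma selfadj_compose:
  assumes "selfadj S" "selfadj T" "S o\<^sub>L T = T o\<^sub>L S"
  shows "selfadj (S o\<^sub>L T)"
  unfolding selfadj_def
proof (intro allI)
  fix b c
  have "star ((S o\<^sub>L T) b) * c = star b * (T o\<^sub>L S) c"
    using assms(1,2) by (simp add: selfadj_swap)
  then show "star ((S o\<^sub>L T) b) * c = star b * (S o\<^sub>L T) c"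
    using assms(3) by simp
qed

lemma closed_selfadj: "closed {T :: 'a::cstar_algebra \<Rightarrow>\<^sub>L 'a. selfadj T}"
  unfolding selfadj_def
  by (intro closed_Collect_all closed_Collect_eq continuous_intros
      bounded_linear.continuous_on[OF bounded_linear_star])

lemma compose_assoc: "(S o\<^sub>L T) o\<^sub>L U = S o\<^sub>L (T o\<^sub>L U)"
  by (rule blinfun_eqI) simp

lemmas compose_simps =
  bounded_bilinear.add_left[OF bounded_bilinear_blinfun_compose]
  bounded_bilinear.add_right[OF bounded_bilinear_blinfun_compose]
  bounded_bilinear.diff_left[OF bounded_bilinear_blinfun_compose]
  bounded_bilinear.diff_right[OF bounded_bilinear_blinfun_compose]
  bounded_bilinear.scaleR_left[OF bounded_bilinear_blinfun_compose]
  bounded_bilinear.scaleR_right[OF bounded_bilinear_blinfun_compose]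
  compose_assoc

lemma compose_id [simp]: "id_blinfun o\<^sub>L T = T" "T o\<^sub>L id_blinfun = T"
  by (auto intro: blinfun_eqI)

text \<open>Only an inequality, since the identity has norm 0 on the zero algebra.\<close>

lemma norm_scaleR_id_le: "norm (r *\<^sub>R (id_blinfun :: 'a::cstar_algebra \<Rightarrow>\<^sub>L 'a)) \<le> \<bar>r\<bar>"
  using mult_left_mono[OF norm_blinfun_id_le, of "\<bar>r\<bar>"] by simp

text \<open>With \<open>D\<close> and \<open>E\<close> commuting, \<open>(D + \<i>E)\<^sup>*(D + \<i>E) = D\<^sup>2 + E\<^sup>2\<close>, and \<open>2D\<close> is the sum of
  \<open>D + \<i>E\<close> and \<open>D - \<i>E\<close>.\<close>

lemma norm_power2_le_sum_squares:
  fixes D E :: "'a::cstar_algebra \<Rightarrow>\<^sub>L 'a"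
  assumes D: "selfadj D" and E: "selfadj E" and comm: "D o\<^sub>L E = E o\<^sub>L D"
  shows "(norm D)\<^sup>2 \<le> norm ((D o\<^sub>L D) + (E o\<^sub>L E))"
proof -
  define K where "K = norm ((D o\<^sub>L D) + (E o\<^sub>L E))"
  have DE: "D (E b) = E (D b)" for b
    using comm by (metis blinfun_apply_blinfun_compose)
  \<comment> \<open>The operator space has real scalars only, so D + wE is treated pointwise. The
    C*-identity gives the same bound for both signs of w.\<close>
  have bound: "norm (D b + w *\<^sub>C E b) \<le> sqrt K * norm b" if w: "w = \<i> \<or> w = - \<i>" for b w
  proof -
    have ww: "cnj w * w = 1" "cnj w = - w" using w by auto
    have "star (D b + w *\<^sub>C E b) * (D b + w *\<^sub>C E b)
        = star (D b) * D b + w *\<^sub>C (star (D b) * E b)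
          + (cnj w *\<^sub>C (star (E b) * D b) + (cnj w * w) *\<^sub>C (star (E b) * E b))"
      by (simp add: star_add star_scaleC distrib_left distrib_right mult_scaleC_left
          mult_scaleC_right scaleC_scaleC scaleC_add_right mult.commute)
    also have "\<dots> = star b * D (D b) + (w *\<^sub>C (star b * D (E b)) + cnj w *\<^sub>C (star b * D (E b)))
        + star b * E (E b)"
      using D E ww by (simp add: selfadj_swap DE scaleC_one)
    also have "w *\<^sub>C (star b * D (E b)) + cnj w *\<^sub>C (star b * D (E b)) = 0"
      by (simp add: ww scaleC_add_left[symmetric])
    finally have "star (D b + w *\<^sub>C E b) * (D b + w *\<^sub>C E b)
        = star b * ((D o\<^sub>L D) + (E o\<^sub>L E)) b"
      by (simp add: plus_blinfun.rep_eq distrib_left)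
    then have "(norm (D b + w *\<^sub>C E b))\<^sup>2 = norm (star b * ((D o\<^sub>L D) + (E o\<^sub>L E)) b)"
      by (metis cstar_identity)
    also have "\<dots> \<le> norm b * (K * norm b)"
      unfolding K_def
      by (rule order_trans[OF norm_mult_ineq]) (simp add: mult_left_mono norm_blinfun)
    also have "\<dots> = (sqrt K * norm b)\<^sup>2"
      by (simp add: power_mult_distrib K_def power2_eq_square)
    finally show ?thesis
      by (rule power2_le_imp_le) (simp add: K_def)
  qed
  have "norm D \<le> sqrt K"
  proof (rule norm_blinfun_bound)
    fix b
    have "2 *\<^sub>R D b = (D b + \<i> *\<^sub>C E b) + (D b + (- \<i>) *\<^sub>C E b)"
      by (simp add: scaleR_2)
    then have "norm (2 *\<^sub>R D b) \<le> sqrt K * norm b + sqrt K * norm b"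
      using norm_triangle_mono[OF bound[of \<i> b] bound[of "- \<i>" b]] by simp
    then show "norm (D b) \<le> sqrt K * norm b" by simp
  qed (simp add: K_def)
  then have "(norm D)\<^sup>2 \<le> (sqrt K)\<^sup>2" by (intro power_mono) auto
  then show ?thesis by (simp add: K_def)
qed

text \<open>The square root is \<open>1 - y\<close>, where \<open>y\<close> is the fixed point of the contraction
  \<open>y \<mapsto> (x + y\<^sup>2)/2\<close> of the ball of radius \<open>\<parallel>x\<parallel>\<close>.\<close>

lemma sqrt_id_minus:
  fixes x :: "'a::cstar_algebra \<Rightarrow>\<^sub>L 'a"
  assumes x: "selfadj x" and nx: "norm x < 1"
  shows "\<exists>d. selfadj d \<and> d o\<^sub>L d = id_blinfun - x \<and>
           (\<forall>z. z o\<^sub>L x = x o\<^sub>L z \<longrightarrow> z o\<^sub>L d = d o\<^sub>L z)"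
proof -
  \<comment> \<open>All three conditions are closed and preserved by \<open>F\<close>, so the fixed
    point inherits them. The third puts it in the double commutant of \<open>x\<close>, the source
    of every later commutation of square roots.\<close>
  define S where "S = {y. norm y \<le> norm x} \<inter> {y. selfadj y} \<inter>
    {y. \<forall>z. z o\<^sub>L x = x o\<^sub>L z \<longrightarrow> z o\<^sub>L y = y o\<^sub>L z}"
  define F where "F y = (1/2) *\<^sub>R (x + (y o\<^sub>L y))" for y :: "'a \<Rightarrow>\<^sub>L 'a"
  have "closed {y. z o\<^sub>L x = x o\<^sub>L z \<longrightarrow> z o\<^sub>L y = y o\<^sub>L z}" for z
  proof (cases "z o\<^sub>L x = x o\<^sub>L z")
    case True
    have "closed {y. z o\<^sub>L y = y o\<^sub>L z}"
      by (intro closed_Collect_eq continuous_intros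
          bounded_bilinear.continuous_on[OF bounded_bilinear_blinfun_compose])
    with True show ?thesis by simp
  qed simp
  then have "closed S"
    unfolding S_def
    by (intro closed_Int closed_selfadj closed_Collect_all closed_Collect_le continuous_intros)
  then have cS: "complete S" by (simp add: complete_eq_closed)
  have "x \<in> S" using x unfolding S_def by blast
  then have neS: "S \<noteq> {}" by blast
  have S: "norm y \<le> norm x" "selfadj y" if "y \<in> S" for y
    using that unfolding S_def by blast+
  have FS: "F ` S \<subseteq> S"
  proof clarify
    fix y assume y: "y \<in> S"
    have "norm (y o\<^sub>L y) \<le> norm y * norm y" by (rule norm_blinfun_compose)
    also have "\<dots> \<le> norm x * 1" using S[OF y] nx by (intro mult_mono) auto
    finally have "norm (F y) \<le> norm x"
      unfolding F_def using norm_triangle_ineq[of x "y o\<^sub>L y"] by simp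
    moreover have "selfadj (F y)"
      unfolding F_def by (intro selfadj_scaleR selfadj_add selfadj_compose x S(2)[OF y] refl)
    moreover have "z o\<^sub>L F y = F y o\<^sub>L z" if z: "z o\<^sub>L x = x o\<^sub>L z" for z
    proof -
      have zy: "z o\<^sub>L y = y o\<^sub>L z" using y z unfolding S_def by blast
      then have "z o\<^sub>L (y o\<^sub>L y) = (y o\<^sub>L y) o\<^sub>L z"
        using compose_assoc[of z y y] compose_assoc[of y z y] compose_assoc[of y y z] by simp
      with z show ?thesis
        by (simp only: F_def compose_simps(1,2,5,6))
    qed
    ultimately show "F y \<in> S" unfolding S_def by blast
  qed
  have lip: "dist (F y) (F z) \<le> norm x * dist y z" if "y \<in> S" "z \<in> S" for y z
  proof -
    have "F y - F z = (1/2) *\<^sub>R ((y o\<^sub>L (y - z)) + ((y - z) o\<^sub>L z))"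
      by (simp add: F_def compose_simps scaleR_diff_right[symmetric])
    moreover have "norm (y o\<^sub>L (y - z)) \<le> norm x * norm (y - z)"
      using S(1) that by (intro order_trans[OF norm_blinfun_compose] mult_right_mono) auto
    moreover have "norm ((y - z) o\<^sub>L z) \<le> norm (y - z) * norm x"
      using S(1) that by (intro order_trans[OF norm_blinfun_compose] mult_left_mono) auto
    ultimately show ?thesis
      using norm_triangle_ineq[of "y o\<^sub>L (y - z)" "(y - z) o\<^sub>L z"]
      by (simp add: dist_norm mult.commute)
  qed
  obtain y where y: "y \<in> S" "F y = y"
    using Banach_fix[OF cS neS norm_ge_zero nx FS lip] by blast
  \<comment> \<open>This is the fixed point equation doubled, which rearranges to (1 - y)(1 - y) = 1
    - x.\<close>
  have "y + y = x + (y o\<^sub>L y)"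
    using arg_cong[OF y(2), of "\<lambda>u. 2 *\<^sub>R u"] by (simp add: F_def scaleR_2)
  then have "(id_blinfun - y) o\<^sub>L (id_blinfun - y) = id_blinfun - x"
    by (simp add: compose_simps algebra_simps)
  moreover have "selfadj (id_blinfun - y)"
    by (intro selfadj_diff selfadj_id S(2)[OF y(1)])
  moreover have "z o\<^sub>L (id_blinfun - y) = (id_blinfun - y) o\<^sub>L z" if "z o\<^sub>L x = x o\<^sub>L z" for z
  proof -
    have "z o\<^sub>L y = y o\<^sub>L z" using y(1) that unfolding S_def by blast
    then show ?thesis by (simp add: compose_simps)
  qed
  ultimately show ?thesis by blast
qed

text \<open>Positivity expressed by norms alone, hence visibly closed under addition.\<close>

definition op_pos :: "('a::cstar_algebra \<Rightarrow>\<^sub>L 'a) \<Rightarrow> bool" where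
  "op_pos T \<longleftrightarrow> selfadj T \<and> (\<exists>M\<ge>0. norm (M *\<^sub>R id_blinfun - T) \<le> M)"

lemma op_pos_add:
  assumes "op_pos S" "op_pos T"
  shows "op_pos (S + T)"
proof -
  obtain K M where "K \<ge> 0" "norm (K *\<^sub>R id_blinfun - S) \<le> K"
    "M \<ge> 0" "norm (M *\<^sub>R id_blinfun - T) \<le> M"
    using assms by (auto simp: op_pos_def)
  moreover from this have "norm ((K + M) *\<^sub>R id_blinfun - (S + T)) \<le> K + M"
    using norm_triangle_mono[of "K *\<^sub>R id_blinfun - S" K "M *\<^sub>R id_blinfun - T" M]
    by (simp add: algebra_simps)
  ultimately show ?thesis
    using assms selfadj_add by (fastforce simp: op_pos_def intro: exI[of _ "K + M"])
qed

lemma op_pos_scaleR_id_minus: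
  assumes "selfadj T" "norm T \<le> M"
  shows "op_pos (M *\<^sub>R id_blinfun - T)"
  unfolding op_pos_def
  using assms order_trans[OF norm_ge_zero assms(2)]
  by (auto intro!: selfadj_diff selfadj_scaleR selfadj_id exI[of _ M])

text \<open>With k = M + \<epsilon>, the operator T + \<epsilon> equals k(1 - x), where x = (M -
  T)/k. The shift by \<epsilon> makes the norm of x at most M/k < 1, as \<open>sqrt_id_minus\<close>
  requires.\<close>

lemma op_pos_sqrt:
  fixes T :: "'a::cstar_algebra \<Rightarrow>\<^sub>L 'a"
  assumes T: "op_pos T" and e: "\<epsilon> > 0"
  shows "\<exists>d. selfadj d \<and> d o\<^sub>L d = T + \<epsilon> *\<^sub>R id_blinfun \<and>
           (\<forall>z. z o\<^sub>L T = T o\<^sub>L z \<longrightarrow> z o\<^sub>L d = d o\<^sub>L z)"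
proof -
  obtain M where sT: "selfadj T" and M: "M \<ge> 0" "norm (M *\<^sub>R id_blinfun - T) \<le> M"
    using T by (auto simp: op_pos_def)
  define k where "k = M + \<epsilon>"
  have k: "k > 0" "M < k" using M e by (auto simp: k_def)
  define x where "x = (1/k) *\<^sub>R (M *\<^sub>R id_blinfun - T)"
  have sx: "selfadj x"
    unfolding x_def by (intro selfadj_scaleR selfadj_diff selfadj_id sT)
  have nx: "norm x < 1" using M k by (simp add: x_def divide_simps)
  obtain d where d: "selfadj d" "d o\<^sub>L d = id_blinfun - x"
      "\<And>z. z o\<^sub>L x = x o\<^sub>L z \<Longrightarrow> z o\<^sub>L d = d o\<^sub>L z"
    using sqrt_id_minus[OF sx nx] by blast
  have "(sqrt k *\<^sub>R d) o\<^sub>L (sqrt k *\<^sub>R d) = k *\<^sub>R (id_blinfun - x)"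
    using k by (simp add: compose_simps d(2))
  also have "\<dots> = T + \<epsilon> *\<^sub>R id_blinfun"
  proof -
    have "k *\<^sub>R x = M *\<^sub>R id_blinfun - T" using k by (simp add: x_def)
    then show ?thesis by (simp add: scaleR_diff_right) (simp add: k_def scaleR_add_left)
  qed
  finally have sq: "(sqrt k *\<^sub>R d) o\<^sub>L (sqrt k *\<^sub>R d) = T + \<epsilon> *\<^sub>R id_blinfun" .
  have "z o\<^sub>L (sqrt k *\<^sub>R d) = (sqrt k *\<^sub>R d) o\<^sub>L z" if "z o\<^sub>L T = T o\<^sub>L z" for z
    using d(3)[of z] that by (simp add: x_def compose_simps)
  with sq selfadj_scaleR[OF d(1)] show ?thesis by blast
qed

text \<open>Scale D to d so that 1 - dd has a square root f. Since ff + dd = 1 and f, d commute, the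
  norm of f is at most 1, and M - DD = M ff then has norm at most M.\<close>

lemma op_pos_square:
  fixes D :: "'a::cstar_algebra \<Rightarrow>\<^sub>L 'a"
  assumes D: "selfadj D"
  shows "op_pos (D o\<^sub>L D)"
proof -
  \<comment> \<open>The summand 1 makes the scaled square strictly smaller than 1 in norm and covers
    D = 0.\<close>
  define M where "M = (norm D)\<^sup>2 + 1"
  have M: "M > 0" by (simp add: M_def add_nonneg_pos)
  define d where "d = (1 / sqrt M) *\<^sub>R D"
  have sd: "selfadj d" unfolding d_def by (intro selfadj_scaleR D)
  have dd: "d o\<^sub>L d = (1 / M) *\<^sub>R (D o\<^sub>L D)"
    using M by (simp add: d_def compose_simps)
  have "norm (D o\<^sub>L D) \<le> (norm D)\<^sup>2"
    using norm_blinfun_compose[of D D] by (simp add: power2_eq_square)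
  then have "norm (d o\<^sub>L d) < 1"
    using M by (simp add: dd divide_simps M_def)
  then obtain f where f: "selfadj f" "f o\<^sub>L f = id_blinfun - (d o\<^sub>L d)"
      "\<And>z. z o\<^sub>L (d o\<^sub>L d) = (d o\<^sub>L d) o\<^sub>L z \<Longrightarrow> z o\<^sub>L f = f o\<^sub>L z"
    using sqrt_id_minus[OF selfadj_compose[OF sd sd refl]] by blast
  have "f o\<^sub>L d = d o\<^sub>L f" using f(3)[of d] by (simp add: compose_assoc)
  from norm_power2_le_sum_squares[OF f(1) sd this]
  have "(norm f)\<^sup>2 \<le> norm (id_blinfun :: 'a \<Rightarrow>\<^sub>L 'a)" by (simp add: f(2))
  then have "(norm f)\<^sup>2 \<le> 1" using norm_blinfun_id_le order_trans by blast
  then have "norm (f o\<^sub>L f) \<le> 1"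
    using norm_blinfun_compose[of f f] by (simp add: power2_eq_square)
  moreover have "M *\<^sub>R id_blinfun - (D o\<^sub>L D) = M *\<^sub>R (f o\<^sub>L f)"
    using M by (simp add: f(2) dd algebra_simps)
  ultimately have "norm (M *\<^sub>R id_blinfun - (D o\<^sub>L D)) \<le> M"
    using M by simp
  then show ?thesis
    using M selfadj_compose[OF D D refl] by (auto simp: op_pos_def intro!: exI[of _ M])
qed

text \<open>Take square roots d of T + \<epsilon> and f of R - T + \<epsilon>. Their squares add up
  to R + 2\<epsilon>, which bounds the norm of dd; subtracting \<epsilon> again costs one more
  \<epsilon>, whence e/3.\<close>

lemma op_pos_norm_le:
  fixes T :: "'a::cstar_algebra \<Rightarrow>\<^sub>L 'a"
  assumes T: "op_pos T" and RT: "op_pos (R *\<^sub>R id_blinfun - T)" and R: "R \<ge> 0"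
  shows "norm T \<le> R"
proof (rule field_le_epsilon)
  fix e :: real assume "e > 0"
  define \<epsilon> where "\<epsilon> = e / 3"
  have e: "\<epsilon> > 0" using \<open>e > 0\<close> by (simp add: \<epsilon>_def)
  obtain d where d: "selfadj d" "d o\<^sub>L d = T + \<epsilon> *\<^sub>R id_blinfun"
      "\<And>z. z o\<^sub>L T = T o\<^sub>L z \<Longrightarrow> z o\<^sub>L d = d o\<^sub>L z"
    using op_pos_sqrt[OF T e] by blast
  obtain f where f: "selfadj f" "f o\<^sub>L f = R *\<^sub>R id_blinfun - T + \<epsilon> *\<^sub>R id_blinfun"
      "\<And>z. z o\<^sub>L (R *\<^sub>R id_blinfun - T) = (R *\<^sub>R id_blinfun - T) o\<^sub>L z \<Longrightarrow> z o\<^sub>L f = f o\<^sub>L z"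
    using op_pos_sqrt[OF RT e] by blast
  \<comment> \<open>Commutation passes in two stages: T commutes with R - T, hence with f; then f
    commutes with T, hence with d.\<close>
  have "T o\<^sub>L f = f o\<^sub>L T" by (rule f(3)) (simp add: compose_simps)
  then have "d o\<^sub>L f = f o\<^sub>L d" using d(3)[of f] by simp
  from norm_power2_le_sum_squares[OF d(1) f(1) this]
  have "(norm d)\<^sup>2 \<le> norm ((R + 2 * \<epsilon>) *\<^sub>R (id_blinfun :: 'a \<Rightarrow>\<^sub>L 'a))"
    by (simp add: d(2) f(2) algebra_simps flip: scaleR_2)
  also have "\<dots> \<le> R + 2 * \<epsilon>"
    using norm_scaleR_id_le[of "R + 2 * \<epsilon>"] R e by (simp del: norm_scaleR)
  finally have "norm (d o\<^sub>L d) \<le> R + 2 * \<epsilon>"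
    using norm_blinfun_compose[of d d] by (simp add: power2_eq_square)
  moreover have "norm T \<le> norm (d o\<^sub>L d) + norm (\<epsilon> *\<^sub>R (id_blinfun :: 'a \<Rightarrow>\<^sub>L 'a))"
    using norm_triangle_ineq4[of "d o\<^sub>L d" "\<epsilon> *\<^sub>R id_blinfun"] by (simp add: d(2) del: norm_scaleR)
  ultimately show "norm T \<le> R + e"
    using norm_scaleR_id_le[where 'a = 'a, of \<epsilon>] e by (simp add: \<epsilon>_def del: norm_scaleR)
qed

section \<open>From spectral positivity of elements to positivity of left multiplications\<close>

definition Lmult :: "'a::cstar_algebra \<Rightarrow> 'a \<Rightarrow>\<^sub>L 'a" where
  "Lmult a = Blinfun ((*) a)"

lemma Lmult_apply [simp]: "Lmult a b = a * b"
  by (simp add: Lmult_def bounded_linear_Blinfun_apply bounded_linear_mult_right)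

lemma Lmult_add: "Lmult (a + b) = Lmult a + Lmult b"
  by (rule blinfun_eqI) (simp add: plus_blinfun.rep_eq distrib_right)

lemma selfadj_Lmult: "star a = a \<Longrightarrow> selfadj (Lmult a)"
  by (simp add: selfadj_def star_mult mult.assoc)

lemma norm_Lmult_le: "norm (Lmult a) \<le> norm a"
  by (rule norm_blinfun_bound) (simp_all add: norm_mult_ineq)

text \<open>Evaluating the operator at a itself gives an element of norm equal to the square of that
  of a, by the C*-identity.\<close>

lemma norm_le_norm_Lmult:
  assumes "star a = a"
  shows "norm a \<le> norm (Lmult a)"
proof (cases "norm a = 0")
  case False
  have "norm a * norm a \<le> norm (Lmult a) * norm a"
    using norm_blinfun[of "Lmult a" a] cstar_identity[of a] assms by (simp add: power2_eq_square)
  with False show ?thesis by simp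
qed simp

text \<open>This is where the spectrum enters: -t lies outside it, so p + t has an inverse (a, c) in
  the unitization. The scalar part forces c = 1/t, so the inverse acts as the operator
  \<open>Lmult a\<close> + 1/t.\<close>

lemma positive_invertible:
  fixes p :: "'a::cstar_algebra"
  assumes p: "positive p" and t: "t > 0"
  shows "\<exists>r. selfadj r \<and> (Lmult p + t *\<^sub>R id_blinfun) o\<^sub>L r = id_blinfun \<and>
           r o\<^sub>L (Lmult p + t *\<^sub>R id_blinfun) = id_blinfun"
proof -
  have "complex_of_real (- t) \<notin> spectrum p"
    using p t by (auto simp: positive_def dest!: subsetD simp: nonneg_Reals_of_real_iff
        simp del: of_real_minus)
  then obtain a c where
    "unitization_mult (p, complex_of_real t) (a, c) = (0, 1)"
    "unitization_mult (a, c) (p, complex_of_real t) = (0, 1)"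
    by (auto simp: spectrum_def)
  then have c: "complex_of_real t * c = 1"
    and pa: "p * a + t *\<^sub>R a + c *\<^sub>C p = 0" and ap: "a * p + c *\<^sub>C p + t *\<^sub>R a = 0"
    by (simp_all add: unitization_mult_def scaleR_scaleC)
  have "c = complex_of_real (1 / t)" using c t by (simp add: field_simps)
  then have cp: "c *\<^sub>C p = (1 / t) *\<^sub>R p" by (simp add: scaleR_scaleC)
  define C where "C = Lmult p + t *\<^sub>R id_blinfun"
  define r where "r = Lmult a + (1 / t) *\<^sub>R id_blinfun"
  have "C (r b) = b" "r (C b) = b" for b
  proof -
    have "C (r b) = (p * a + t *\<^sub>R a + (1 / t) *\<^sub>R p) * b + b"
      using t by (simp add: C_def r_def plus_blinfun.rep_eq scaleR_blinfun.rep_eq algebra_simps)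
    then show "C (r b) = b" using pa cp by simp
    have "r (C b) = (a * p + (1 / t) *\<^sub>R p + t *\<^sub>R a) * b + b"
      using t by (simp add: C_def r_def plus_blinfun.rep_eq scaleR_blinfun.rep_eq algebra_simps)
    then show "r (C b) = b" using ap cp by simp
  qed
  note inv = this
  have sC: "selfadj C"
    using p unfolding C_def positive_def
    by (intro selfadj_add selfadj_scaleR selfadj_id selfadj_Lmult) auto
  have "selfadj r"
    unfolding selfadj_def
  proof (intro allI)
    fix b d
    have "star (r b) * d = star (r b) * C (r d)" by (simp add: inv)
    also have "\<dots> = star (C (r b)) * r d" by (simp add: selfadj_swap[OF sC])
    finally show "star (r b) * d = star b * r d" by (simp add: inv)
  qed
  moreover have "C o\<^sub>L r = id_blinfun" "r o\<^sub>L C = id_blinfun"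
    by (auto intro: blinfun_eqI simp: inv)
  ultimately show ?thesis unfolding C_def by blast
qed

text \<open>A positive operator \<open>c\<close> with inverse \<open>r\<close> is bounded below, because
  \<open>(c + \<epsilon>)(1 - \<delta>r)\<close> is a square and approximates \<open>c - \<delta>\<close>.\<close>

lemma op_pos_invertible_minus:
  fixes c r :: "'a::cstar_algebra \<Rightarrow>\<^sub>L 'a"
  assumes c: "op_pos c" and r: "selfadj r" and cr: "c o\<^sub>L r = id_blinfun"
    and rc: "r o\<^sub>L c = id_blinfun" and k: "k > 0"
  shows "\<exists>\<eta>>0. \<eta> \<le> k \<and> op_pos (c - \<eta> *\<^sub>R id_blinfun)"
proof -
  \<comment> \<open>Since \<delta> times the norm of r is below 1/2, 1 - \<delta>r has a square
    root, and the choice \<epsilon> = \<delta>/4 leaves \<eta> positive. The minimum with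
    \<open>k\<close> yields \<eta> \<le> k; adding 1 to the norm of r avoids division by
    zero.\<close>
  define \<delta> where "\<delta> = min k (1 / (2 * (norm r + 1)))"
  define \<epsilon> where "\<epsilon> = \<delta> / 4"
  define \<eta> where "\<eta> = \<delta> - \<epsilon> - \<epsilon> * \<delta> * norm r"
  have nr: "norm r + 1 > 0" by (simp add: add_nonneg_pos)
  have dpos: "\<delta> > 0" using k nr by (simp add: \<delta>_def)
  have "\<delta> \<le> 1 / (2 * (norm r + 1))" by (simp add: \<delta>_def)
  then have "\<delta> * (2 * (norm r + 1)) \<le> 1" using nr by (simp add: field_simps)
  then have dr: "\<delta> * norm r < 1 / 2" using dpos by (simp add: algebra_simps)
  have epos: "\<epsilon> > 0" using dpos by (simp add: \<epsilon>_def)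
  have "\<epsilon> * (\<delta> * norm r) \<le> \<epsilon> * (1 / 2)" using epos dr by (intro mult_left_mono) auto
  then have "\<epsilon> * \<delta> * norm r \<le> \<epsilon> / 2" by (simp add: mult.assoc)
  moreover have "0 \<le> \<epsilon> * \<delta> * norm r" "\<delta> = 4 * \<epsilon>" "\<delta> \<le> k"
    using dpos epos by (simp_all add: \<epsilon>_def \<delta>_def)
  ultimately have eta: "\<eta> > 0" "\<eta> \<le> k"
    unfolding \<eta>_def using epos by linarith+
  obtain d where d: "selfadj d" "d o\<^sub>L d = c + \<epsilon> *\<^sub>R id_blinfun"
      "\<And>z. z o\<^sub>L c = c o\<^sub>L z \<Longrightarrow> z o\<^sub>L d = d o\<^sub>L z"
    using op_pos_sqrt[OF c epos] by blast
  have "norm (\<delta> *\<^sub>R r) < 1" using dr dpos by simp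
  then obtain f where f: "selfadj f" "f o\<^sub>L f = id_blinfun - \<delta> *\<^sub>R r"
      "\<And>z. z o\<^sub>L (\<delta> *\<^sub>R r) = (\<delta> *\<^sub>R r) o\<^sub>L z \<Longrightarrow> z o\<^sub>L f = f o\<^sub>L z"
    using sqrt_id_minus[OF selfadj_scaleR[OF r]] by blast
  have "r o\<^sub>L d = d o\<^sub>L r" by (rule d(3)) (simp add: rc cr)
  then have fd: "d o\<^sub>L f = f o\<^sub>L d" using f(3)[of d] by (simp add: compose_simps)
  have "(d o\<^sub>L f) o\<^sub>L (d o\<^sub>L f) = (d o\<^sub>L d) o\<^sub>L (f o\<^sub>L f)"
    by (metis fd compose_assoc)
  also have "\<dots> = c + \<epsilon> *\<^sub>R id_blinfun - \<delta> *\<^sub>R id_blinfun - (\<epsilon> * \<delta>) *\<^sub>R r"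
    by (simp add: d(2) f(2) compose_simps cr algebra_simps)
  finally have sq: "op_pos (c + \<epsilon> *\<^sub>R id_blinfun - \<delta> *\<^sub>R id_blinfun - (\<epsilon> * \<delta>) *\<^sub>R r)"
    using op_pos_square[OF selfadj_compose[OF d(1) f(1) fd]] by simp
  \<comment> \<open>Adding this operator cancels the term in r left over in the square, at the price
    of the last summand of \<eta>.\<close>
  have "op_pos ((\<epsilon> * \<delta> * norm r) *\<^sub>R id_blinfun - (- (\<epsilon> * \<delta>)) *\<^sub>R r)"
    using epos dpos by (intro op_pos_scaleR_id_minus selfadj_scaleR r) (simp add: abs_mult)
  from op_pos_add[OF sq this] have "op_pos (c - \<eta> *\<^sub>R id_blinfun)"
    by (simp add: \<eta>_def algebra_simps)
  with eta show ?thesis by blast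
qed

text \<open>If \<open>s = \<parallel>L\<^sub>p\<parallel> - L\<^sub>p\<close> had norm larger than \<open>\<parallel>L\<^sub>p\<parallel>\<close>, then \<open>\<parallel>s\<parallel> - s\<close> would be
  invertible, hence bounded below, which would force the norm of \<open>s\<close> to be smaller than it is.\<close>

lemma positive_imp_op_pos:
  fixes p :: "'a::cstar_algebra"
  assumes p: "positive p"
  shows "op_pos (Lmult p)"
proof -
  define M where "M = norm (Lmult p)"
  define s where "s = M *\<^sub>R id_blinfun - Lmult p"
  have sp: "selfadj (Lmult p)" using p by (simp add: positive_def selfadj_Lmult)
  have ss: "op_pos s" unfolding s_def by (rule op_pos_scaleR_id_minus[OF sp]) (simp add: M_def)
  then have sa: "selfadj s" by (simp add: op_pos_def)
  have "norm s \<le> M"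
  proof (rule ccontr)
    assume "\<not> norm s \<le> M"
    then have t: "norm s - M > 0" by simp
    have M0: "M \<ge> 0" by (simp add: M_def)
    define c where "c = Lmult p + (norm s - M) *\<^sub>R id_blinfun"
    have cs: "c = norm s *\<^sub>R id_blinfun - s" by (simp add: c_def s_def algebra_simps)
    have c: "op_pos c" unfolding cs by (rule op_pos_scaleR_id_minus[OF sa order_refl])
    obtain r where r: "selfadj r" "c o\<^sub>L r = id_blinfun" "r o\<^sub>L c = id_blinfun"
      using positive_invertible[OF p t] unfolding c_def by blast
    \<comment> \<open>The cap \<eta> \<le> \<open>norm s\<close> keeps the radius
      \<open>norm s - \<eta>\<close> nonnegative for \<open>op_pos_norm_le\<close>.\<close>
    obtain \<eta> where eta: "\<eta> > 0" "\<eta> \<le> norm s" "op_pos (c - \<eta> *\<^sub>R id_blinfun)"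
      using op_pos_invertible_minus[OF c r, of "norm s"] t M0 by (metis diff_gt_0_iff_gt le_less_trans)
    have "op_pos ((norm s - \<eta>) *\<^sub>R id_blinfun - s)"
      using eta(3) by (simp add: cs algebra_simps)
    then have "norm s \<le> norm s - \<eta>"
      using eta(2) by (intro op_pos_norm_le[OF ss]) auto
    with eta(1) show False by simp
  qed
  then show ?thesis
    using sp unfolding op_pos_def s_def by (auto simp: M_def intro!: exI[of _ M])
qed

text \<open>With R the norm of p + q, the operator R - p is the sum of the positive operators R - (p
  + q) and q, so \<open>op_pos_norm_le\<close> bounds p by R.\<close>

lemma norm_positive_le_norm_add:
  fixes p q :: "'a::cstar_algebra"
  assumes p: "positive p" and q: "positive q"
  shows "norm p \<le> norm (p + q)"
proof -
  have s: "star p = p" "star q = q" using p q by (auto simp: positive_def)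
  have "op_pos (norm (p + q) *\<^sub>R id_blinfun - Lmult (p + q))"
    using s by (intro op_pos_scaleR_id_minus norm_Lmult_le selfadj_Lmult) (simp add: star_add)
  from op_pos_add[OF this positive_imp_op_pos[OF q]]
  have "op_pos (norm (p + q) *\<^sub>R id_blinfun - Lmult p)" by (simp add: Lmult_add)
  from op_pos_norm_le[OF positive_imp_op_pos[OF p] this] norm_le_norm_Lmult[OF s(1)]
  show ?thesis by simp
qed

subsection \<open>The projection onto an adjointable submodule\<close>

lemma inner_productD:
  assumes "inner_product M"
  shows "x \<in> carr M \<Longrightarrow> y \<in> carr M \<Longrightarrow> z \<in> carr M \<Longrightarrow> ip M (x + y) z = ip M x z + ip M y z"
    and "x \<in> carr M \<Longrightarrow> y \<in> carr M \<Longrightarrow> ip M (c *\<^sub>C x) y = c *\<^sub>C ip M x y"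
    and "x \<in> carr M \<Longrightarrow> y \<in> carr M \<Longrightarrow> ip M (lact M a x) y = a * ip M x y"
    and "x \<in> carr M \<Longrightarrow> y \<in> carr M \<Longrightarrow> ip M x y = star (ip M y x)"
    and "x \<in> carr M \<Longrightarrow> positive (ip M x x)"
    and "x \<in> carr M \<Longrightarrow> ip M x x = 0 \<Longrightarrow> x = 0"
  by (rule assms[unfolded inner_product_def, THEN conjunct1, rule_format]
      assms[unfolded inner_product_def, THEN conjunct2, THEN conjunct1, rule_format]
      assms[unfolded inner_product_def, THEN conjunct2, THEN conjunct2, THEN conjunct1, rule_format]
      assms[unfolded inner_product_def, THEN conjunct2, THEN conjunct2, THEN conjunct2,
        THEN conjunct1, rule_format]
      assms[unfolded inner_product_def, THEN conjunct2, THEN conjunct2, THEN conjunct2,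
        THEN conjunct2, THEN conjunct1, rule_format]
      assms[unfolded inner_product_def, THEN conjunct2, THEN conjunct2, THEN conjunct2,
        THEN conjunct2, THEN conjunct2, rule_format]; assumption)+

lemma inner_product_right:
  assumes L: "left_module M" and I: "inner_product M"
    and x: "x \<in> carr M" and y: "y \<in> carr M" and z: "z \<in> carr M"
  shows "ip M x (y + z) = ip M x y + ip M x z"
    and "ip M x (y - z) = ip M x y - ip M x z"
    and "ip M x (k *\<^sub>C y) = cnj k *\<^sub>C ip M x y"
    and "ip M x (lact M a y) = ip M x y * star a"
    and "ip M (y - z) x = ip M y x - ip M z x"
proof -
  have sub: "complex_vector.subspace (carr M)" and la: "lact M a y \<in> carr M"
    using L y unfolding left_module_def by blast+
  note closure = complex_vector.subspace_add[OF sub] complex_vector.subspace_diff[OF sub]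
    complex_vector.subspace_scale[OF sub]
  have flip: "ip M u v = star (ip M v u)" if "u \<in> carr M" "v \<in> carr M" for u v
    by (rule inner_productD(4)[OF I that])
  have add: "ip M (u + v) w = ip M u w + ip M v w"
    if "u \<in> carr M" "v \<in> carr M" "w \<in> carr M" for u v w
    by (rule inner_productD(1)[OF I that])
  have diff: "ip M (u - v) w = ip M u w - ip M v w"
    if "u \<in> carr M" "v \<in> carr M" "w \<in> carr M" for u v w
    using add[of "u - v" v w] that closure(2) by simp
  show "ip M x (y + z) = ip M x y + ip M x z"
    using flip[of x "y + z"] flip[of x y] flip[of x z] add[of y z x] x y z closure(1)
    by (simp add: star_add)
  show "ip M x (y - z) = ip M x y - ip M x z"
    using flip[of x "y - z"] flip[of x y] flip[of x z] diff[of y z x] x y z closure(2)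
    by (simp add: star_diff)
  have "ip M (k *\<^sub>C y) x = k *\<^sub>C ip M y x" by (rule inner_productD(2)[OF I y x])
  then show "ip M x (k *\<^sub>C y) = cnj k *\<^sub>C ip M x y"
    using flip[of x "k *\<^sub>C y"] flip[of x y] x y closure(3) by (simp add: star_scaleC)
  have "ip M (lact M a y) x = a * ip M y x" by (rule inner_productD(3)[OF I y x])
  then show "ip M x (lact M a y) = ip M x y * star a"
    using flip[of x "lact M a y"] flip[of x y] x y la by (simp add: star_mult)
  show "ip M (y - z) x = ip M y x - ip M z x" using diff x y z by blast
qed

lemma hilbert_submodule_ops:
  assumes "hilbert_submodule M N"
  shows "lact M = lact N" "ip M = ip N" "ract M = ract N"
proof -
  have eq: "M = N\<lparr>carr := carr M\<rparr>" using assms by (simp add: hilbert_submodule_def)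
  show "lact M = lact N" using arg_cong[OF eq, of lact] by simp
  show "ip M = ip N" using arg_cong[OF eq, of ip] by simp
  show "ract M = ract N" using arg_cong[OF eq, of ract] by simp
qed

text \<open>\<open>is_adjoint\<close> gives P only its range and the pairing identity. Linearity and
  compatibility with both actions come from \<open>uniq\<close>: P x is determined by its inner
  products with M.\<close>

lemma adjointable_submodule_projection:
  fixes N M :: "('a::cstar_algebra, 'n::complex_vector, 'b::cstar_algebra) hbimod"
  assumes N: "hilbert_bimodule N" and M: "adjointable_submodule M N"
  shows "\<exists>P. contractive_bimodule_map N M P \<and> is_adjoint M N (\<lambda>x. x) P \<and> (\<forall>x\<in>carr M. P x = x)"
proof -
  have L: "left_module N" and I: "inner_product N"
    and rep: "star_representation N (\<lambda>b x. ract N x b)"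
    using N by (auto simp: hilbert_bimodule_def hilbert_module_def)
  have sub: "hilbert_submodule M N" using M by (simp add: adjointable_submodule_def)
  note MN = hilbert_submodule_ops[OF sub]
  have carrM: "x \<in> carr N" if "x \<in> carr M" for x
    using sub that by (auto simp: hilbert_submodule_def)
  have sM: "complex_vector.subspace (carr M)"
    and lM: "\<And>a x. x \<in> carr M \<Longrightarrow> lact N a x \<in> carr M"
    and rM: "\<And>b x. x \<in> carr M \<Longrightarrow> ract N x b \<in> carr M"
    using sub by (auto simp: hilbert_submodule_def)
  have sN: "complex_vector.subspace (carr N)"
    and lN: "\<And>a x. x \<in> carr N \<Longrightarrow> lact N a x \<in> carr N"
    using L unfolding left_module_def by blast+
  \<comment> \<open>The adjoint of the action of \<open>star b\<close> is the action of
    \<open>star (star b)\<close>, that is of b, and adjoints map into the carrier.\<close>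
  have rN: "ract N x b \<in> carr N" if "x \<in> carr N" for b x
    using rep that unfolding star_representation_def is_adjoint_def by (metis star_star)
  have radj: "ip N (ract N x b) y = ip N x (ract N y (star b))"
    if "x \<in> carr N" "y \<in> carr N" for b x y
    using rep that unfolding star_representation_def is_adjoint_def by blast
  obtain P where P: "is_adjoint M N (\<lambda>x. x) P"
    using M by (auto simp: adjointable_submodule_def adjointable_def)
  have PM: "P x \<in> carr M" if "x \<in> carr N" for x
    using P that by (simp add: is_adjoint_def)
  have PN: "P x \<in> carr N" if "x \<in> carr N" for x
    using PM carrM that by blast
  have adj: "ip N m (P x) = ip N m x" if "m \<in> carr M" "x \<in> carr N" for m x
    using P that by (simp add: is_adjoint_def MN)
  have uniq: "P x = y" if x: "x \<in> carr N" and y: "y \<in> carr M"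
    and eq: "\<And>m. m \<in> carr M \<Longrightarrow> ip N m y = ip N m x" for x y
  proof -
    \<comment> \<open>The difference lies in M, so it may be paired with itself; definiteness then
      makes it zero.\<close>
    have d: "P x - y \<in> carr M" using PM[OF x] y complex_vector.subspace_diff[OF sM] by blast
    have "ip N (P x - y) (P x - y) = ip N (P x - y) (P x) - ip N (P x - y) y"
      by (rule inner_product_right(2)[OF L I carrM[OF d] PN[OF x] carrM[OF y]])
    also have "\<dots> = 0" using adj[OF d x] eq[OF d] by simp
    finally have "P x - y = 0"
      by (rule inner_productD(6)[OF I carrM[OF d]])
    then show ?thesis by simp
  qed
  have add: "P (x + y) = P x + P y" if x: "x \<in> carr N" and y: "y \<in> carr N" for x y
  proof (rule uniq)
    show "x + y \<in> carr N" using x y complex_vector.subspace_add[OF sN] by blast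
    show "P x + P y \<in> carr M" using PM[OF x] PM[OF y] complex_vector.subspace_add[OF sM] by blast
    show "ip N m (P x + P y) = ip N m (x + y)" if "m \<in> carr M" for m
      using that x y by (simp add: inner_product_right[OF L I] carrM PN adj)
  qed
  have scale: "P (k *\<^sub>C x) = k *\<^sub>C P x" if x: "x \<in> carr N" for k x
  proof (rule uniq)
    show "k *\<^sub>C x \<in> carr N" using x complex_vector.subspace_scale[OF sN] by blast
    show "k *\<^sub>C P x \<in> carr M" using PM[OF x] complex_vector.subspace_scale[OF sM] by blast
    show "ip N m (k *\<^sub>C P x) = ip N m (k *\<^sub>C x)" if "m \<in> carr M" for m
      using that x by (simp add: inner_product_right(3)[OF L I _ _ x] carrM PN adj)
  qed
  have act: "P (lact N a x) = lact N a (P x)" if x: "x \<in> carr N" for a x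
  proof (rule uniq)
    show "ip N m (lact N a (P x)) = ip N m (lact N a x)" if "m \<in> carr M" for m
      using that x by (simp add: inner_product_right(4)[OF L I _ _ x] carrM PN adj)
  qed (use x lN lM PM in auto)
  have ract: "P (ract N x b) = ract N (P x) b" if x: "x \<in> carr N" for b x
  proof (rule uniq)
    fix m assume m: "m \<in> carr M"
    \<comment> \<open>Moving b onto m stays inside M by right invariance, so P can be removed there
      before b is moved back.\<close>
    have "ip N m (ract N (P x) b) = ip N (ract N m (star b)) (P x)"
      using radj[of m "P x" "star b"] m x by (simp add: carrM PN star_star)
    also have "\<dots> = ip N (ract N m (star b)) x" using m x by (simp add: adj rM)
    also have "\<dots> = ip N m (ract N x b)"
      using radj[of m x "star b"] m x by (simp add: carrM star_star)
    finally show "ip N m (ract N (P x) b) = ip N m (ract N x b)" .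
  qed (use x rN rM PM in auto)
  have contr: "hnorm M (P x) \<le> hnorm N x" if x: "x \<in> carr N" for x
  proof -
    define p where "p = ip N (P x) (P x)"
    define y where "y = x - P x"
    have y: "y \<in> carr N" using x PN[OF x] complex_vector.subspace_diff[OF sN] by (simp add: y_def)
    have pos: "positive (ip N z z)" if "z \<in> carr N" for z
      by (rule inner_productD(5)[OF I that])
    have flip: "ip N u v = star (ip N v u)" if "u \<in> carr N" "v \<in> carr N" for u v
      by (rule inner_productD(4)[OF I that])
    have Px: "ip N (P x) x = p" using adj[OF PM[OF x] x] by (simp add: p_def)
    have "star p = p" using pos[OF PN[OF x]] by (simp add: p_def positive_def)
    then have xP: "ip N x (P x) = p" using flip[OF x PN[OF x]] Px by simp
    \<comment> \<open>The inner products of x with P x, of P x with x and of P x with itself all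
      equal \<open>p\<close>, so one copy survives.\<close>
    have "ip N y y = ip N x x - p"
      using inner_product_right(2)[OF L I y x PN[OF x]]
        inner_product_right(5)[OF L I x x PN[OF x]]
        inner_product_right(5)[OF L I PN[OF x] x PN[OF x]]
      by (simp add: y_def[symmetric] Px xP p_def[symmetric])
    then have "ip N x x = p + ip N y y" by simp
    then have "norm p \<le> norm (ip N x x)"
      using norm_positive_le_norm_add[OF pos[OF PN[OF x]] pos[OF y]] by (simp add: p_def)
    then show ?thesis by (simp add: hnorm_def MN p_def)
  qed
  have "P x = x" if "x \<in> carr M" for x
    by (rule uniq) (use that carrM in auto)
  moreover have "contractive_bimodule_map N M P"
    unfolding contractive_bimodule_map_def bimodule_map_def module_map_def contractive_map_def MN
    using PM add scale act ract contr by blast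
  ultimately show ?thesis using P by blast
qed

section \<open>Extension of morphisms along the projection\<close>

lemma is_adjoint_compose:
  assumes "is_adjoint M E T S" "is_adjoint N M P Q" "\<And>x. x \<in> carr N \<Longrightarrow> P x \<in> carr M"
  shows "is_adjoint N E (T \<circ> P) (Q \<circ> S)"
  using assms by (auto simp: is_adjoint_def)

lemma bounded_map_compose_contractive:
  assumes T: "bounded_map M E T" and P: "contractive_map N M P"
    and PM: "\<And>x. x \<in> carr N \<Longrightarrow> P x \<in> carr M"
  shows "bounded_map N E (T \<circ> P)"
proof -
  obtain K where K: "\<And>x. x \<in> carr M \<Longrightarrow> hnorm E (T x) \<le> K * hnorm M x"
    using T by (auto simp: bounded_map_def)
  \<comment> \<open>A bound in \<open>bounded_map\<close> may be negative; its absolute value makes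
    the estimate monotone.\<close>
  have "hnorm E (T (P x)) \<le> \<bar>K\<bar> * hnorm N x" if x: "x \<in> carr N" for x
  proof -
    have "hnorm E (T (P x)) \<le> K * hnorm M (P x)" using K PM x by blast
    also have "\<dots> \<le> \<bar>K\<bar> * hnorm M (P x)"
      by (intro mult_right_mono) (auto simp: hnorm_def)
    also have "\<dots> \<le> \<bar>K\<bar> * hnorm N x"
      using P x by (intro mult_left_mono) (auto simp: contractive_map_def)
    finally show ?thesis .
  qed
  then show ?thesis by (auto simp: bounded_map_def)
qed

text \<open>The same extension serves all four categories, because precomposition with P preserves
  contractivity, boundedness, adjointability and the bimodule property.\<close>

lemma hilbert_bimodule_injective:
  fixes E :: "('a::cstar_algebra, 'e::complex_vector, 'b::cstar_algebra) hbimod"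
    and mor :: "('a, 'n::complex_vector, 'b) hbimod \<Rightarrow> ('a, 'e, 'b) hbimod \<Rightarrow> ('n \<Rightarrow> 'e) \<Rightarrow> bool"
  assumes E: "hilbert_bimodule E"
    and mor: "mor \<in> {contractive_bimodule_map, adjointable_contractive_bimodule_map,
                   bounded_bimodule_map, adjointable_bounded_bimodule_map}"
  shows "injective_object adjointable_submodule mor E"
  unfolding injective_object_def
proof (intro conjI allI impI E)
  fix N M :: "('a, 'n, 'b) hbimod" and \<phi>
  assume *: "hilbert_bimodule N \<and> adjointable_submodule M N \<and> mor M E \<phi>"
  then have phi: "mor M E \<phi>" by blast
  obtain P where cP: "contractive_bimodule_map N M P"
    and aP: "is_adjoint M N (\<lambda>x. x) P" and fP: "\<forall>x\<in>carr M. P x = x"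
    using adjointable_submodule_projection * by blast
  have bP: "bimodule_map N M P" and kP: "contractive_map N M P"
    using cP by (auto simp: contractive_bimodule_map_def)
  have PM: "P x \<in> carr M" if "x \<in> carr N" for x
    using bP that by (auto simp: bimodule_map_def module_map_def)
  have bimod: "bimodule_map N E (\<phi> \<circ> P)" if "bimodule_map M E \<phi>"
    using that bP by (simp add: bimodule_map_def module_map_def)
  have contr: "contractive_map N E (\<phi> \<circ> P)" if "contractive_map M E \<phi>"
    using that kP PM unfolding contractive_map_def comp_def by (meson order_trans)
  have bounded: "bounded_map N E (\<phi> \<circ> P)" if "bounded_map M E \<phi>"
    by (rule bounded_map_compose_contractive[OF that kP PM])
  have sub: "hilbert_submodule M N" using * by (simp add: adjointable_submodule_def)
  note IM = hilbert_submodule_ops(2)[OF sub]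
  have IN: "inner_product N" and MN: "carr M \<subseteq> carr N"
    using * sub by (simp_all add: hilbert_bimodule_def hilbert_module_def hilbert_submodule_def)
  have adj: "adjointable N E (\<phi> \<circ> P)" if a: "adjointable M E \<phi>" and b: "bimodule_map M E \<phi>"
  proof -
    obtain S where S: "is_adjoint M E \<phi> S" using a by (auto simp: adjointable_def)
    \<comment> \<open>The inclusion is in turn an adjoint of P, by symmetry of the inner product, so
      an adjoint of the extension is \<open>S\<close> followed by the inclusion.\<close>
    have "is_adjoint N M P (\<lambda>x. x)"
      unfolding is_adjoint_def IM
    proof (intro conjI ballI)
      fix x y assume x: "x \<in> carr N" and y: "y \<in> carr M"
      have xN: "P x \<in> carr N" and yN: "y \<in> carr N" using PM[OF x] y MN by auto
      have "ip N (P x) y = star (ip N y (P x))" by (rule inner_productD(4)[OF IN xN yN])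
      also have "ip N y (P x) = ip N y x" using aP x y by (simp add: is_adjoint_def IM)
      also have "star (ip N y x) = ip N x y" by (rule inner_productD(4)[OF IN x yN, symmetric])
      finally show "ip N (P x) y = ip N x y" .
    qed (use MN in auto)
    from is_adjoint_compose[OF S this PM]
    have "is_adjoint N E (\<phi> \<circ> P) ((\<lambda>x. x) \<circ> S)" .
    then show ?thesis
      using bimod[OF b] bounded a unfolding adjointable_def bimodule_map_def by blast
  qed
  have "mor N E (\<phi> \<circ> P)"
    using mor phi bimod contr bounded adj
    by (auto simp: contractive_bimodule_map_def adjointable_contractive_bimodule_map_def
        bounded_bimodule_map_def adjointable_bounded_bimodule_map_def)
  then show "\<exists>\<psi>. mor N E \<psi> \<and> (\<forall>x\<in>carr M. \<psi> x = \<phi> x)"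
    using fP by (intro exI[of _ "\<phi> \<circ> P"]) simp
qed

text \<open>The two records have different types, so the predicates are unfolded down to the fields,
  on which they agree.\<close>

lemma hilbert_bimodule_bimodule_of:
  assumes "hilbert_module E" "star_representation E \<rho>"
  shows "hilbert_bimodule (bimodule_of E \<rho>)"
proof -
  have ops: "carr (bimodule_of E \<rho>) = carr E" "lact (bimodule_of E \<rho>) = lact E"
    "ip (bimodule_of E \<rho>) = ip E" "ract (bimodule_of E \<rho>) = (\<lambda>x b. \<rho> b x)"
    by (simp_all add: bimodule_of_def)
  have "hilbert_module (bimodule_of E \<rho>)"
    using assms(1)
    unfolding hilbert_module_def left_module_def inner_product_def hCauchy_def hconverges_def
      hnorm_def ops .
  moreover have "star_representation (bimodule_of E \<rho>) (\<lambda>b x. ract (bimodule_of E \<rho>) x b)"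
    using assms(2)
    unfolding star_representation_def End_star_def adjointable_def
      module_map_def bounded_map_def is_adjoint_def hnorm_def ops .
  ultimately show ?thesis unfolding hilbert_bimodule_def ..
qed

theorem theorem3p1:
  fixes E :: "('a::cstar_algebra, 'e::complex_vector) hmod"
    and \<rho> :: "'b::cstar_algebra \<Rightarrow> 'e \<Rightarrow> 'e"
  assumes "hilbert_module E"
    and "star_representation E \<rho>"
  shows "(\<forall>mor :: ('a, 'n::complex_vector, 'b) hbimod \<Rightarrow> ('a, 'e, 'b) hbimod \<Rightarrow> ('n \<Rightarrow> 'e) \<Rightarrow> bool.
            mor \<in> {contractive_bimodule_map, adjointable_contractive_bimodule_map,
                   bounded_bimodule_map, adjointable_bounded_bimodule_map} \<longrightarrow>
            injective_object adjointable_submodule mor (bimodule_of E \<rho>)) \<and>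
         (\<forall>mor :: ('a, 'n, 'b) hbimod \<Rightarrow> ('a, 'f::complex_vector, 'b) hbimod \<Rightarrow> ('n \<Rightarrow> 'f) \<Rightarrow> bool.
            mor \<in> {contractive_bimodule_map, adjointable_contractive_bimodule_map,
                   bounded_bimodule_map, adjointable_bounded_bimodule_map} \<longrightarrow>
            (\<forall>F :: ('a, 'f, 'b) hbimod. hilbert_bimodule F \<longrightarrow>
               injective_object adjointable_submodule mor F))"
proof (intro conjI allI impI)
  show "injective_object adjointable_submodule mor (bimodule_of E \<rho>)"
    if "mor \<in> {contractive_bimodule_map, adjointable_contractive_bimodule_map,
                   bounded_bimodule_map, adjointable_bounded_bimodule_map}"
    for mor :: "('a, 'n, 'b) hbimod \<Rightarrow> ('a, 'e, 'b) hbimod \<Rightarrow> ('n \<Rightarrow> 'e) \<Rightarrow> bool"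
    using hilbert_bimodule_injective[OF hilbert_bimodule_bimodule_of[OF assms] that] .
qed (rule hilbert_bimodule_injective)

end
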